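(* For all $K,R\in\{1,2,3\}$, the structural scheme with parameters $(K,R)$ is A-stable, i.e. its amplification function satisfies $|\chi_R(z)|\le 1$ for all $z\in\mathbb{C}$ with $\operatorname{Re} z\le 0$.
   Context: Let $K,R\ge1$ be integers, $M=(K+1)(R+1)$ and $\ell(k,r)=1+k(R+1)+r$ for $0\le k\le K$, $0\le r\le R$. Let $\mathcal{M}$ be the $M\times M$ matrix with entries $\mathcal{M}[m,\ell(k,r)]=\frac{(m-1)!}{(m-1-k)!}r^{m-1-k}$ if $m>k$ (with $0^0=1$) and $0$ otherwise. $\mathcal{K}^R\subset\mathbb{R}^M$ is the kernel of the $(M-R)\times M$ matrix formed by the first $M-R$ rows of $\mathcal{M}$; it has dimension $R$. Equivalently, $\mathbf{a}=(a_{k,r})\in\mathcal{K}^R$ iff $\sum_{k=0}^K\sum_{r=0}^R a_{k,r}\pi^{(k)}(r)=0$ for all polynomials $\pi$ of degree at most $K(R+1)$. Let $\mathbf{a}^s=(a^s_{k,r})_{k,r}$, $s=1,\dots,R$, be a basis of $\mathcal{K}^R$. The structural scheme with parameters $(K,R)$ applied to $\phi'=\lambda\phi$, $\lambda\in\mathbb{C}$, with step $\Delta t$ and $z=\lambda\Delta t$, uses $\phi^{(k)}_{n+r}=\lambda^k\phi^{(0)}_{n+r}$ and the $R$ equations $\sum_{k=0}^K\sum_{r=0}^R a^s_{k,r}\Delta t^k\phi^{(k)}_{n+r}=0$, $s=1,\dots,R$. With $g_{s,r}(z)=\sum_{k=0}^K a^s_{k,r}z^k$, $\boldsymbol{G}(z)=(g_{s,r}(z))_{s,r=1}^R$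 and $\mathbf{b}(z)=(g_{s,0}(z))_{s=1}^R$, this reads $\boldsymbol{G}(z)(\phi^{(0)}_{n+1},\dots,\phi^{(0)}_{n+R})^{\mathrm t}=-\mathbf{b}(z)\phi^{(0)}_n$. The amplification vector is $\boldsymbol{\chi}(z)=-\boldsymbol{G}(z)^{-1}\mathbf{b}(z)=(\chi_1(z),\dots,\chi_R(z))^{\mathrm t}$ and $\chi_R(z)$, its last entry (a rational function of $z$, independent of the choice of basis), is the amplification (transfer) function at time $t_{n+R}$. *)

theory Defs
  imports
    Complex_Main
    "Jordan_Normal_Form.Gauss_Jordan_Elimination"
    "Jordan_Normal_Form.Matrix_Kernel"
begin

definition struct_dim :: "nat \<Rightarrow> nat \<Rightarrow> nat" where
  "struct_dim K R = (K + 1) * (R + 1)"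

definition ell :: "nat \<Rightarrow> nat \<Rightarrow> nat \<Rightarrow> nat" where
  "ell R k r = 1 + k * (R + 1) + r"

text \<open>The value at \<open>r\<close> of the \<open>k\<close>-th derivative of the monomial of degree \<open>m - 1\<close>.\<close>

definition struct_entry :: "nat \<Rightarrow> nat \<Rightarrow> nat \<Rightarrow> real" where
  "struct_entry m k r =
     (if m > k then fact (m - 1) / fact (m - 1 - k) * real r ^ (m - 1 - k) else 0)"

text \<open>Matrix and vector indices of the library start at 0, whereas \<open>m\<close> and \<open>ell R k r\<close> start
  at 1; every access below is therefore shifted by one. Column \<open>j\<close> is \<open>ell R k r - 1\<close> for
  \<open>k = j div (R + 1)\<close> and \<open>r = j mod (R + 1)\<close>.\<close>

definition struct_matrix :: "nat \<Rightarrow> nat \<Rightarrow> real mat" where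
  "struct_matrix K R = mat (struct_dim K R) (struct_dim K R)
     (\<lambda>(i, j). struct_entry (i + 1) (j div (R + 1)) (j mod (R + 1)))"

lemma ell_bounds:
  assumes "k \<le> K" "r \<le> R"
  shows "1 \<le> ell R k r" "ell R k r \<le> struct_dim K R"
proof -
  show "1 \<le> ell R k r" by (simp add: ell_def)
  have "k * (R + 1) \<le> K * (R + 1)" using assms(1) by (rule mult_le_mono1)
  then show "ell R k r \<le> struct_dim K R"
    using assms(2) by (simp add: ell_def struct_dim_def)
qed

lemma struct_matrix_entry:
  assumes "1 \<le> m" "m \<le> struct_dim K R" "k \<le> K" "r \<le> R"
  shows "struct_matrix K R $$ (m - 1, ell R k r - 1) = struct_entry m k r"
proof -
  have j: "ell R k r - 1 = r + k * (R + 1)" by (simp add: ell_def)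
  have "(r + k * (R + 1)) div (R + 1) = k" "(r + k * (R + 1)) mod (R + 1) = r"
    using assms(4) by (simp_all only: div_mult_self1 mod_mult_self1) simp_all
  moreover have "ell R k r - 1 < struct_dim K R" "m - 1 < struct_dim K R"
    using ell_bounds[OF assms(3,4)] assms(1,2) by linarith+
  ultimately show ?thesis
    using assms(1) unfolding struct_matrix_def j by simp
qed

definition struct_rows :: "nat \<Rightarrow> nat \<Rightarrow> real mat" where
  "struct_rows K R = mat (struct_dim K R - R) (struct_dim K R) (\<lambda>ij. struct_matrix K R $$ ij)"

text \<open>The library's notion of basis concerns sets; the basis of the scheme is the indexed family
  \<open>a 1, \<dots>, a R\<close>.\<close>

definition kernel_basis :: "nat \<Rightarrow> nat \<Rightarrow> (nat \<Rightarrow> real vec) \<Rightarrow> bool" where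
  "kernel_basis K R a \<longleftrightarrow>
     inj_on a {1..R} \<and> kernel.basis (struct_dim K R) (struct_rows K R) (a ` {1..R})"

definition scheme_coeff :: "nat \<Rightarrow> (nat \<Rightarrow> real vec) \<Rightarrow> nat \<Rightarrow> nat \<Rightarrow> nat \<Rightarrow> real" where
  "scheme_coeff R a s k r = a s $ (ell R k r - 1)"

definition g_poly :: "nat \<Rightarrow> nat \<Rightarrow> (nat \<Rightarrow> real vec) \<Rightarrow> nat \<Rightarrow> nat \<Rightarrow> complex \<Rightarrow> complex" where
  "g_poly K R a s r z = (\<Sum>k = 0..K. of_real (scheme_coeff R a s k r) * z ^ k)"

definition G_mat :: "nat \<Rightarrow> nat \<Rightarrow> (nat \<Rightarrow> real vec) \<Rightarrow> complex \<Rightarrow> complex mat" where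
  "G_mat K R a z = mat R R (\<lambda>(i, j). g_poly K R a (i + 1) (j + 1) z)"

definition b_vec :: "nat \<Rightarrow> nat \<Rightarrow> (nat \<Rightarrow> real vec) \<Rightarrow> complex \<Rightarrow> complex vec" where
  "b_vec K R a z = vec R (\<lambda>i. g_poly K R a (i + 1) 0 z)"

text \<open>Only meaningful where \<open>G_mat K R a z\<close> is invertible.\<close>

definition amplification_vec :: "nat \<Rightarrow> nat \<Rightarrow> (nat \<Rightarrow> real vec) \<Rightarrow> complex \<Rightarrow> complex vec" where
  "amplification_vec K R a z = - (the (mat_inverse (G_mat K R a z)) *\<^sub>v b_vec K R a z)"

definition amplification :: "nat \<Rightarrow> nat \<Rightarrow> (nat \<Rightarrow> real vec) \<Rightarrow> complex \<Rightarrow> complex" where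
  "amplification K R a z = amplification_vec K R a z $ (R - 1)"

text \<open>Invertibility of \<open>G_mat K R a z\<close> says that \<open>amplification\<close> is defined at \<open>z\<close>; without it the
  bound would be a statement about an unspecified value.\<close>

definition A_stable :: "nat \<Rightarrow> nat \<Rightarrow> (nat \<Rightarrow> real vec) \<Rightarrow> bool" where
  "A_stable K R a \<longleftrightarrow>
     (\<forall>z. Re z \<le> 0 \<longrightarrow> invertible_mat (G_mat K R a z) \<and> cmod (amplification K R a z) \<le> 1)"

end

theory Submission
  imports Defs "Jordan_Normal_Form.Char_Poly"
begin

text \<open>By orthogonality to the kernel, the values \<open>\<phi>\<^sub>r\<close> solve the scheme iff some polynomial
  \<open>\<pi>\<close> of degree at most \<open>N = K (R + 1)\<close> satisfies \<open>\<pi>\<^sup>(\<^sup>k\<^sup>)(r) = z\<^sup>k \<phi>\<^sub>r\<close> for \<open>k \<le> K\<close>, i.e. iff \<open>\<pi>' - z \<pi>\<close>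
  is a multiple of \<open>W = (x (x - 1) \<dots> (x - R))\<^sup>K\<close>. Solving this equation gives, up to a factor,
  \<open>\<phi>\<^sub>r = \<Sum>\<^sub>j z\<^sup>N\<^sup>-\<^sup>j W\<^sup>(\<^sup>j\<^sup>)(r)\<close>. With \<open>P(z) = \<Sum>\<^sub>j z\<^sup>N\<^sup>-\<^sup>j W\<^sup>(\<^sup>j\<^sup>)(0)\<close>, the symmetry \<open>x \<mapsto> R - x\<close> turns the
  amplification function into \<open>P(- z) / P(z)\<close>. For \<open>Re w \<ge> 0\<close> the quotient of the parts
  \<open>u\<close>, \<open>v\<close> of \<open>P(- w)\<close> of the two parities is a continued fraction with positive coefficients, hence
  has nonnegative real part; this gives \<open>u + v \<noteq> 0\<close> and \<open>\<bar>u - v\<bar> \<le> \<bar>u + v\<bar>\<close>.\<close>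

section \<open>Higher derivatives of polynomials at a point\<close>

lemma higher_pderiv_pcompose_linear:
  "(pderiv ^^ j) (pcompose p [:c, d:]) = Polynomial.smult (d ^ j) (pcompose ((pderiv ^^ j) p) [:c, d:])"
  by (induction j)
     (simp_all add: pderiv_smult pderiv_pcompose pderiv_pCons mult_smult_right mult.commute)

lemma poly_higher_pderiv:
  "poly ((pderiv ^^ j) p) c = fact j * coeff (pcompose p [:c, 1:]) j"
proof -
  have "poly ((pderiv ^^ j) p) c = coeff ((pderiv ^^ j) (pcompose p [:c, 1:])) 0"
    by (simp add: higher_pderiv_pcompose_linear poly_pcompose flip: poly_0_coeff_0)
  then show ?thesis
    by (simp add: coeff_higher_pderiv pochhammer_fact)
qed

text \<open>Translating \<open>c\<close> to 0 turns the power into the monomial x^n, and the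
  derivative of order \<open>j\<close> into a Taylor coefficient: zero below \<open>n\<close>, and
  the constant term of the shifted \<open>p\<close> at \<open>n\<close>.\<close>

lemma poly_higher_pderiv_power_mult:
  fixes c :: "'a :: {idom, semiring_char_0}"
  assumes "j \<le> n"
  shows "poly ((pderiv ^^ j) ([:- c, 1:] ^ n * p)) c = (if j = n then fact n * poly p c else 0)"
proof -
  have "pcompose ([:- c, 1:] ^ n * p) [:c, 1:] = monom 1 n * pcompose p [:c, 1:]"
    by (simp add: pcompose_mult pcompose_hom.hom_power pcompose_pCons monom_altdef)
  then show ?thesis
    using assms by (simp add: poly_higher_pderiv coeff_monom_mult poly_pcompose flip: poly_0_coeff_0)
qed

text \<open>With D for \<open>pderiv\<close>, this is the factorisation of D^k - z^k by D - z. If D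
  q - z q vanishes to high order at a point, then q behaves there like exp (z x).\<close>

lemma higher_pderiv_minus_smult:
  fixes q :: "'a :: idom poly"
  shows "(pderiv ^^ k) q - Polynomial.smult (z ^ k) q
    = (\<Sum>j<k. Polynomial.smult (z ^ (k - 1 - j)) ((pderiv ^^ j) (pderiv q - Polynomial.smult z q)))"
proof (induction k)
  case (Suc k)
  have "(pderiv ^^ Suc k) q - Polynomial.smult (z ^ Suc k) q
      = pderiv ((pderiv ^^ k) q - Polynomial.smult (z ^ k) q) + Polynomial.smult (z ^ k) (pderiv q - Polynomial.smult z q)"
    by (simp add: pderiv_diff pderiv_smult smult_diff_right mult.commute)
  also have "\<dots> = (\<Sum>j<k. Polynomial.smult (z ^ (k - Suc j)) ((pderiv ^^ Suc j) (pderiv q - Polynomial.smult z q)))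
      + Polynomial.smult (z ^ k) (pderiv q - Polynomial.smult z q)"
    unfolding Suc by (simp add: higher_pderiv_sum[of 1, simplified] pderiv_smult)
  finally show ?case
    by (simp add: sum.lessThan_Suc_shift add.commute del: sum.lessThan_Suc)
qed simp

section \<open>Polynomial solutions of q' - z q = p\<close>

definition resolvent_sum :: "nat \<Rightarrow> 'a :: idom \<Rightarrow> 'a poly \<Rightarrow> 'a poly" where
  "resolvent_sum N z p = (\<Sum>j\<le>N. Polynomial.smult (z ^ (N - j)) ((pderiv ^^ j) p))"

lemma degree_resolvent_sum:
  fixes p :: "'a :: {idom, semiring_char_0} poly"
  shows "degree (resolvent_sum N z p) \<le> degree p"
  unfolding resolvent_sum_def
  by (rule degree_sum_le)
     (auto intro!: order.trans[OF degree_smult_le] simp: degree_higher_pderiv)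

text \<open>Up to the factor z^(N+1), \<open>resolvent_sum\<close> is the Neumann series of (z -
  D)^(-1) p, finite because D is nilpotent on polynomials of bounded degree. The factor clears all
  denominators, so z = 0 is allowed. Applying D and multiplying by z give the same sum up to the
  term j = 0.\<close>

lemma pderiv_resolvent_sum:
  fixes p :: "'a :: {idom, semiring_char_0} poly"
  assumes "degree p \<le> N"
  shows "pderiv (resolvent_sum N z p) - Polynomial.smult z (resolvent_sum N z p) = - Polynomial.smult (z ^ Suc N) p"
proof -
  have top: "(pderiv ^^ Suc N) p = 0"
    using assms by (simp add: pderiv_eq_0_iff degree_higher_pderiv)
  have "pderiv (resolvent_sum N z p) = (\<Sum>j\<le>N. Polynomial.smult (z ^ (N - j)) ((pderiv ^^ Suc j) p))"
    by (simp add: resolvent_sum_def higher_pderiv_sum[of 1, simplified] pderiv_smult)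
  also have "\<dots> = (\<Sum>j<N. Polynomial.smult (z ^ (N - j)) ((pderiv ^^ Suc j) p))"
    using top by (simp flip: lessThan_Suc_atMost)
  finally have 1: "pderiv (resolvent_sum N z p) = \<dots>" .
  have "Polynomial.smult z (resolvent_sum N z p) = (\<Sum>j\<le>N. Polynomial.smult (z ^ (Suc N - j)) ((pderiv ^^ j) p))"
    by (simp add: resolvent_sum_def smult_sum2 Suc_diff_le)
  also have "\<dots> = Polynomial.smult (z ^ Suc N) p + (\<Sum>j<N. Polynomial.smult (z ^ (N - j)) ((pderiv ^^ Suc j) p))"
    by (subst lessThan_Suc_atMost[symmetric], subst sum.lessThan_Suc_shift) simp
  finally show ?thesis
    by (simp add: 1)
qed

text \<open>For z = 0 an antiderivative serves, and it raises the degree by one, hence the strict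
  bound on \<open>p\<close>. For other z the resolvent sum is normalised by its factor
  z^(N+1).\<close>

lemma pderiv_minus_smult_surj:
  fixes p :: "'a :: field_char_0 poly"
  assumes "degree p < N"
  obtains q where "degree q \<le> N" "pderiv q - Polynomial.smult z q = p"
proof (cases "z = 0")
  case True
  define q where "q = (\<Sum>i\<le>degree p. monom (coeff p i / of_nat (Suc i)) (Suc i))"
  have "degree q \<le> N"
    unfolding q_def using assms
    by (intro degree_sum_le) (auto intro: order.trans[OF degree_monom_le])
  moreover have "pderiv q = p"
    by (simp add: q_def higher_pderiv_sum[of 1, simplified] pderiv_monom
        poly_as_sum_of_monoms del: of_nat_Suc)
  ultimately show ?thesis
    using True that by simp
next
  case False
  let ?c = "- inverse (z ^ Suc N)"
  have "pderiv (Polynomial.smult ?c (resolvent_sum N z p)) - Polynomial.smult z (Polynomial.smult ?c (resolvent_sum N z p))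
      = Polynomial.smult ?c (pderiv (resolvent_sum N z p) - Polynomial.smult z (resolvent_sum N z p))"
    by (simp add: pderiv_smult pderiv_minus smult_diff_right mult.commute)
  also have "\<dots> = Polynomial.smult (inverse (z ^ Suc N) * z ^ Suc N) p"
    using assms by (simp add: pderiv_resolvent_sum del: power_Suc power_inverse)
  also have "inverse (z ^ Suc N) * z ^ Suc N = 1"
    using False by (intro left_inverse) simp
  finally show ?thesis
    using that degree_resolvent_sum[of N z p] assms unfolding smult_1_left
    by (metis degree_smult_le order.trans less_imp_le)
qed

section \<open>The nodal polynomial and its reflection symmetry\<close>

definition nodal :: "nat \<Rightarrow> 'a :: idom poly" where
  "nodal R = (\<Prod>r\<le>R. [:- of_nat r, 1:])"

lemma degree_nodal: "degree (nodal R :: 'a :: idom poly) = Suc R"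
  by (simp add: nodal_def degree_prod_sum_eq)

lemma nodal_reflect: "pcompose (nodal R :: 'a :: idom poly) [:of_nat R, - 1:] = (- 1) ^ Suc R * nodal R"
proof -
  have "pcompose (nodal R :: 'a poly) [:of_nat R, - 1:] = (\<Prod>r\<le>R. [:of_nat R - of_nat r, - 1:])"
    by (simp add: nodal_def pcompose_prod pcompose_pCons)
  also have "\<dots> = (\<Prod>r\<le>R. (- 1) * [:- of_nat (R - r), 1:])"
    by (intro prod.cong) (simp_all add: of_nat_diff)
  also have "\<dots> = (- 1) ^ Suc R * (\<Prod>r\<le>R. [:- of_nat (R - r), 1:])"
    by (simp only: prod.distrib prod_constant card_atMost)
  also have "(\<Prod>r\<le>R. [:- of_nat (R - r), 1:]) = (\<Prod>r\<le>R. [:- of_nat r, 1 :: 'a:])"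
    using prod.nat_diff_reindex[of "\<lambda>r. [:- of_nat r, 1 :: 'a:]" "Suc R"]
    by (simp add: lessThan_Suc_atMost)
  finally show ?thesis
    by (simp add: nodal_def)
qed

definition stage_value :: "nat \<Rightarrow> nat \<Rightarrow> nat \<Rightarrow> complex \<Rightarrow> complex" where
  "stage_value K R r z = poly (resolvent_sum (K * (R + 1)) z (nodal R ^ K)) (of_nat r)"

text \<open>Under x -> R - x the polynomial W acquires the sign (-1)^N and its derivative of order j
  a further (-1)^j. The total sign equals (-1)^(N-j), which is absorbed by z^(N-j) when z becomes
  -z.\<close>

lemma stage_value_reflect: "stage_value K R R z = stage_value K R 0 (- z)"
proof -
  let ?N = "K * (R + 1)" and ?W = "nodal R ^ K :: complex poly"
  have "((- 1) ^ Suc R) ^ K = ((- 1) ^ ?N :: complex poly)"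
    by (metis power_mult mult.commute Suc_eq_plus1)
  then have "pcompose ?W [:of_nat R, - 1:] = (- 1) ^ ?N * ?W"
    by (simp only: pcompose_hom.hom_power nodal_reflect power_mult_distrib)
  then have W: "pcompose ?W [:of_nat R, - 1:] = Polynomial.smult ((- 1) ^ ?N) ?W"
    by (cases "even ?N") auto
  have "poly ((pderiv ^^ j) ?W) (of_nat R) = (- 1) ^ (?N + j) * poly ((pderiv ^^ j) ?W) 0" for j
  proof -
    have eq: "(- 1) ^ j * poly ((pderiv ^^ j) ?W) (of_nat R) = (- 1) ^ ?N * poly ((pderiv ^^ j) ?W) 0"
    proof -
      have "(- 1) ^ j * poly ((pderiv ^^ j) ?W) (of_nat R)
        = poly ((pderiv ^^ j) (pcompose ?W [:of_nat R, - 1:])) 0"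
        by (simp only: higher_pderiv_pcompose_linear) (simp add: poly_pcompose)
      then show ?thesis
        unfolding W by (simp only: higher_pderiv_smult poly_smult)
    qed
    have "poly ((pderiv ^^ j) ?W) (of_nat R) = (- 1) ^ j * ((- 1) ^ j * poly ((pderiv ^^ j) ?W) (of_nat R))"
      by (cases "even j") (simp_all del: of_nat_mult)
    then show ?thesis
      unfolding eq power_add by (simp only: mult_ac)
  qed
  moreover have "(- 1) ^ (?N + j) = (- 1 :: complex) ^ (?N - j)" if "j \<le> ?N" for j
    using that by (intro neg_one_power_add_eq_neg_one_power_diff)
  ultimately show ?thesis
    unfolding stage_value_def resolvent_sum_def poly_sum poly_smult of_nat_0
    by (intro sum.cong) (simp_all add: power_minus[of z] del: of_nat_mult of_nat_Suc)
qed

section \<open>Hermite functionals exact up to degree K (R + 1)\<close>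

definition hermite_form :: "nat \<Rightarrow> nat \<Rightarrow> (nat \<Rightarrow> nat \<Rightarrow> complex) \<Rightarrow> complex poly \<Rightarrow> complex" where
  "hermite_form K R \<alpha> p = (\<Sum>k\<le>K. \<Sum>r\<le>R. \<alpha> k r * poly ((pderiv ^^ k) p) (of_nat r))"

lemma nodal_power_dvd:
  assumes "r \<le> R"
  shows "\<exists>s. nodal R ^ K = [:- of_nat r, 1:] ^ K * (s :: complex poly)"
proof -
  have "nodal R = [:- of_nat r, 1:] * (\<Prod>i\<in>{..R} - {r}. [:- of_nat i, 1 :: complex:])"
    unfolding nodal_def using assms by (intro prod.remove) auto
  then show ?thesis
    by (metis power_mult_distrib)
qed

text \<open>The functional is applied to the resolvent sum q of W. Its degree is within the range of
  exactness, and its k-th derivative at a node is z^k times its value there.\<close>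

lemma stage_value_relation:
  assumes exact: "\<And>p. degree p \<le> K * (R + 1) \<Longrightarrow> hermite_form K R \<alpha> p = 0"
  shows "(\<Sum>r\<le>R. stage_value K R r z * (\<Sum>k\<le>K. \<alpha> k r * z ^ k)) = 0"
proof -
  let ?N = "K * (R + 1)" and ?W = "nodal R ^ K :: complex poly"
  let ?q = "resolvent_sum ?N z ?W"
  have dW: "degree ?W \<le> ?N"
    using degree_power_le[of "nodal R :: complex poly" K] by (simp add: degree_nodal mult.commute)
  have "poly ((pderiv ^^ k) ?q) (of_nat r) = z ^ k * stage_value K R r z"
    if k: "k \<le> K" and r: "r \<le> R" for k r
  proof -
    obtain s where s: "?W = [:- of_nat r, 1:] ^ K * s"
      using nodal_power_dvd[OF r] by blast
    \<comment> \<open>The difference D^k q - z^k q involves only derivatives of W of order below k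
      <= K, and W has a zero of order at least K at each node.\<close>
    have "poly ((pderiv ^^ j) ?W) (of_nat r) = 0" if "j < k" for j
      unfolding s using that k by (subst poly_higher_pderiv_power_mult) auto
    then have "poly ((pderiv ^^ k) ?q - Polynomial.smult (z ^ k) ?q) (of_nat r) = 0"
      unfolding higher_pderiv_minus_smult pderiv_resolvent_sum[OF dW]
      by (simp add: poly_sum higher_pderiv_smult flip: smult_minus_left)
    then show ?thesis
      by (simp add: stage_value_def)
  qed
  then have "hermite_form K R \<alpha> ?q
      = (\<Sum>k\<le>K. \<Sum>r\<le>R. stage_value K R r z * (\<alpha> k r * z ^ k))"
    unfolding hermite_form_def by (intro sum.cong) auto
  also have "\<dots> = (\<Sum>r\<le>R. stage_value K R r z * (\<Sum>k\<le>K. \<alpha> k r * z ^ k))"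
    by (subst sum.swap) (simp add: sum_distrib_left)
  finally show ?thesis
    using exact[of ?q] order.trans[OF degree_resolvent_sum dW] by simp
qed

text \<open>In \<open>form\<close> below the functional is rewritten as a Hermite functional of order \<open>K - 1\<close> in
  \<open>q' - z q\<close>, which ranges over all polynomials of degree less than \<open>K (R + 1)\<close>; hence all its
  coefficients \<open>\<beta>\<close> vanish.\<close>

lemma hermite_form_eq_0_imp:
  assumes exact: "\<And>p. degree p \<le> K * (R + 1) \<Longrightarrow> hermite_form K R \<alpha> p = 0"
    and vanish: "\<And>r. r \<le> R \<Longrightarrow> (\<Sum>k\<le>K. \<alpha> k r * z ^ k) = 0"
    and "k \<le> K" "r \<le> R"
  shows "\<alpha> k r = 0"
proof -
  \<comment> \<open>These are the coefficients of the quotient of the polynomial with coefficients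
    \<open>\<alpha> k r\<close> by x - z; the remainder is zero by \<open>vanish\<close>.\<close>
  define \<beta> where "\<beta> j r = (\<Sum>k=Suc j..K. \<alpha> k r * z ^ (k - 1 - j))" for j r
  have form: "hermite_form K R \<alpha> q
      = (\<Sum>r\<le>R. \<Sum>j<K. \<beta> j r * poly ((pderiv ^^ j) (pderiv q - Polynomial.smult z q)) (of_nat r))" for q
  proof -
    let ?p = "pderiv q - Polynomial.smult z q"
    have "hermite_form K R \<alpha> q = (\<Sum>r\<le>R. (\<Sum>k\<le>K. \<alpha> k r * poly ((pderiv ^^ k) q) (of_nat r))
        - (\<Sum>k\<le>K. \<alpha> k r * z ^ k) * poly q (of_nat r))"
      unfolding hermite_form_def by (subst sum.swap) (simp add: vanish)
    also have "\<dots> = (\<Sum>r\<le>R. \<Sum>k\<le>K. \<alpha> k r * poly ((pderiv ^^ k) q - Polynomial.smult (z ^ k) q) (of_nat r))"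
      by (simp add: sum_distrib_right sum_subtractf right_diff_distrib mult.assoc)
    also have "\<dots> = (\<Sum>r\<le>R. \<Sum>k\<le>K. \<Sum>j<k. \<alpha> k r * z ^ (k - 1 - j) * poly ((pderiv ^^ j) ?p) (of_nat r))"
      unfolding higher_pderiv_minus_smult by (simp add: poly_sum sum_distrib_left mult.assoc)
    also have "\<dots> = (\<Sum>r\<le>R. \<Sum>j<K. \<beta> j r * poly ((pderiv ^^ j) ?p) (of_nat r))"
      unfolding \<beta>_def by (subst sum.nested_swap') (simp add: sum_distrib_right)
    finally show ?thesis .
  qed
  \<comment> \<open>Downward induction on \<open>j\<close>, starting from the highest order K -
    1.\<close>
  have \<beta>0: "\<beta> j r = 0" if "j < K" "r \<le> R" for j r
    using that
  proof (induction "K - j" arbitrary: j rule: less_induct)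
    case less
    define s where "s = (\<Prod>i\<in>{..R} - {r}. [:- of_nat i, 1 :: complex:])"
    have ds: "degree s = R"
      using less.prems by (simp add: s_def degree_prod_sum_eq)
    \<comment> \<open>A test polynomial that isolates \<open>\<beta> j r\<close>: it vanishes to
      order K at the other nodes and to order exactly j at r. Its degree is at most j + K R, which
      is below K (R + 1) since j < K.\<close>
    define p where "p = [:- of_nat r, 1:] ^ j * s ^ K"
    have "degree p \<le> j + K * R"
      unfolding p_def using ds degree_power_le[of s K] degree_mult_le[of "[:- of_nat r, 1:] ^ j" "s ^ K"]
      by (simp add: degree_linear_power mult.commute)
    then have "degree p < K * (R + 1)"
      using less.prems by simp
    then obtain q where q: "degree q \<le> K * (R + 1)" "pderiv q - Polynomial.smult z q = p"
      using pderiv_minus_smult_surj by blast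
    have other: "poly ((pderiv ^^ i) p) (of_nat r') = 0" if "i < K" "r' \<le> R" "r' \<noteq> r" for i r'
    proof -
      have "s = [:- of_nat r', 1:] * (\<Prod>i\<in>{..R} - {r} - {r'}. [:- of_nat i, 1:])"
        unfolding s_def using that by (intro prod.remove) auto
      then obtain t where t: "s ^ K = [:- of_nat r', 1:] ^ K * t"
        by (metis power_mult_distrib)
      have "p = [:- of_nat r', 1:] ^ K * ([:- of_nat r, 1:] ^ j * t)"
        unfolding p_def t by (simp only: mult_ac)
      then show ?thesis
        using that poly_higher_pderiv_power_mult[of i K "of_nat r'"] by simp
    qed
    \<comment> \<open>Orders below j disappear through the zero of \<open>p\<close> at r, orders
      above j through the induction hypothesis.\<close>
    have same: "\<beta> i r * poly ((pderiv ^^ i) p) (of_nat r)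
        = (if i = j then \<beta> j r * (fact j * poly s (of_nat r) ^ K) else 0)" if "i < K" for i
      using that less poly_higher_pderiv_power_mult[of i j "of_nat r" "s ^ K"]
      by (cases "i \<le> j") (auto simp: p_def)
    have "0 = hermite_form K R \<alpha> q"
      using exact q by simp
    also have "\<dots> = (\<Sum>r'\<le>R. if r' = r then \<Sum>i<K. \<beta> i r * poly ((pderiv ^^ i) p) (of_nat r) else 0)"
      unfolding form q(2) by (intro sum.cong) (auto simp: other)
    also have "\<dots> = (\<Sum>i<K. \<beta> i r * poly ((pderiv ^^ i) p) (of_nat r))"
      using less.prems by simp
    also have "\<dots> = \<beta> j r * (fact j * poly s (of_nat r) ^ K)"
      using less.prems by (simp add: same)
    finally show ?case
      by (auto simp: s_def poly_prod)
  qed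
  \<comment> \<open>Horner's recursion
    \<open>\<beta> (k - 1) r = \<alpha> k r + z * \<beta> k r\<close> recovers the coefficients of
    positive order; \<open>vanish\<close> then settles order 0.\<close>
  have pos: "\<alpha> k r = 0" if "0 < k" "k \<le> K" for k
  proof -
    have "\<beta> (k - 1) r = (\<Sum>i=k..K. \<alpha> i r * z ^ (i - k))"
      using that by (simp add: \<beta>_def)
    also have "\<dots> = \<alpha> k r + (\<Sum>i=Suc k..K. \<alpha> i r * z ^ (i - k))"
      using that by (simp add: sum.atLeast_Suc_atMost)
    also have "(\<Sum>i=Suc k..K. \<alpha> i r * z ^ (i - k)) = z * \<beta> k r"
    proof -
      have "z ^ (i - k) = z * z ^ (i - 1 - k)" if "i \<in> {Suc k..K}" for i
        using that by (simp add: Suc_diff_Suc flip: power_Suc)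
      then show ?thesis
        unfolding \<beta>_def sum_distrib_left by (intro sum.cong) auto
    qed
    also have "\<beta> k r = 0"
      \<comment> \<open>For k = K, outside the range of \<open>\<beta>0\<close>, the defining sum is
        empty.\<close>
      using \<beta>0[of k r] that \<open>r \<le> R\<close> by (cases "k < K") (auto simp: \<beta>_def)
    finally show ?thesis
      using \<beta>0[of "k - 1" r] that \<open>r \<le> R\<close> by simp
  qed
  have "(\<Sum>k\<le>K. \<alpha> k r * z ^ k) = \<alpha> 0 r"
    using pos by (subst sum.atMost_shift) simp
  then show ?thesis
    using pos[of k] vanish[of r] assms(3,4) by (cases "k = 0") auto
qed

section \<open>Kernel vectors of the structural matrix as exact Hermite functionals\<close>

lemma struct_entry_eq_poly:
  "complex_of_real (struct_entry (Suc i) k r) = poly ((pderiv ^^ k) (monom 1 i)) (of_nat r)"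
proof (cases "k \<le> i")
  case True
  have "coeff ((pderiv ^^ k) (monom 1 i)) n = coeff (monom (fact i / fact (i - k)) (i - k) :: complex poly) n" for n
  proof (cases "n + k = i")
    case eq: True
    then have i: "i = n + k"
      by simp
    have "fact (n + k) = (fact n * pochhammer (of_nat (Suc n)) k :: complex)"
      using pochhammer_product'[of "1 :: complex" n k] by (simp add: pochhammer_fact add.commute)
    then show ?thesis
      unfolding i by (simp add: coeff_higher_pderiv field_simps del: of_nat_Suc)
  qed (use True in \<open>auto simp: coeff_higher_pderiv\<close>)
  then have "(pderiv ^^ k) (monom 1 i) = (monom (fact i / fact (i - k)) (i - k) :: complex poly)"
    by (rule poly_eqI)
  then show ?thesis
    using True by (simp add: struct_entry_def poly_monom)
next
  case False
  then have "(pderiv ^^ k) (monom (1 :: complex) i) = 0"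
    by (intro poly_eqI) (simp add: coeff_higher_pderiv)
  then show ?thesis
    using False by (simp add: struct_entry_def)
qed

lemma sum_ell:
  "(\<Sum>j<struct_dim K R. f j) = (\<Sum>k\<le>K. \<Sum>r\<le>R. f (ell R k r - 1))"
proof -
  have "sum f {k * Suc R..<k * Suc R + Suc R} = (\<Sum>r\<le>R. f (ell R k r - 1))" for k
  proof -
    have "sum f {0 + k * Suc R..<Suc R + k * Suc R} = (\<Sum>r\<in>{0..<Suc R}. f (r + k * Suc R))"
      by (rule sum.shift_bounds_nat_ivl)
    also have "\<dots> = (\<Sum>r\<le>R. f (ell R k r - 1))"
      by (intro sum.cong) (auto simp: ell_def ac_simps)
    finally show ?thesis
      by (simp only: add_0 add.commute)
  qed
  then have "(\<Sum>k<Suc K. \<Sum>r\<le>R. f (ell R k r - 1)) = sum f {..<Suc K * Suc R}"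
    using sum.nat_group[of f "Suc R" "Suc K"] by simp
  then show ?thesis
    by (simp add: struct_dim_def lessThan_Suc_atMost del: sum.lessThan_Suc)
qed

lemma hermite_form_sum:
  "hermite_form K R \<alpha> (\<Sum>i\<in>I. Polynomial.smult (c i) (q i)) = (\<Sum>i\<in>I. c i * hermite_form K R \<alpha> (q i))"
  by (induction I rule: infinite_finite_induct)
     (simp_all add: hermite_form_def higher_pderiv_add higher_pderiv_smult distrib_left sum.distrib
        sum_distrib_left mult.left_commute)

text \<open>The M - R = K (R + 1) + 1 rows test the functional on the monomials 1, x, ..., x^(K (R +
  1)); linearity does the rest.\<close>

lemma hermite_form_kernel_vector:
  assumes v: "v \<in> mat_kernel (struct_rows K R)" and p: "degree p \<le> K * (R + 1)"
  shows "hermite_form K R (\<lambda>k r. of_real (v $ (ell R k r - 1))) p = 0"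
proof -
  let ?h = "hermite_form K R (\<lambda>k r. of_real (v $ (ell R k r - 1)))"
  have rows: "struct_rows K R \<in> carrier_mat (struct_dim K R - R) (struct_dim K R)"
    by (simp add: struct_rows_def)
  have N: "struct_dim K R - R = Suc (K * (R + 1))"
    by (simp add: struct_dim_def)
  have monomial: "?h (monom 1 i) = 0" if i: "i \<le> K * (R + 1)" for i
  proof -
    have i': "i < struct_dim K R - R"
      using i N by simp
    have entry: "struct_rows K R $$ (i, ell R k r - 1) = struct_entry (Suc i) k r"
      if "k \<le> K" "r \<le> R" for k r
      using struct_matrix_entry[of "Suc i" K R k r] ell_bounds[of k K r R] that i'
      by (simp add: struct_rows_def)
    have "0 = (struct_rows K R *\<^sub>v v) $ i"
      using mat_kernelD[OF rows v] i' by simp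
    also have "\<dots> = (\<Sum>j<struct_dim K R. struct_rows K R $$ (i, j) * v $ j)"
      using mat_kernelD(1)[OF rows v] rows i'
      by (auto simp: scalar_prod_def atLeast0LessThan intro!: sum.cong)
    also have "\<dots> = (\<Sum>k\<le>K. \<Sum>r\<le>R. struct_entry (Suc i) k r * v $ (ell R k r - 1))"
      unfolding sum_ell by (simp add: entry del: One_nat_def)
    finally have "complex_of_real 0 = \<dots>"
      by (rule arg_cong)
    then show ?thesis
      by (simp add: hermite_form_def mult.commute flip: struct_entry_eq_poly)
  qed
  have "?h p = ?h (\<Sum>i\<le>K * (R + 1). Polynomial.smult (coeff p i) (monom 1 i))"
    by (simp only: smult_monom mult_1_right poly_as_sum_of_monoms'[OF p])
  also have "\<dots> = (\<Sum>i\<le>K * (R + 1). coeff p i * ?h (monom 1 i))"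
    by (rule hermite_form_sum)
  finally show ?thesis
    using monomial by simp
qed

lemma kernel_basisD:
  assumes "kernel_basis K R a"
  shows "s \<in> {1..R} \<Longrightarrow> a s \<in> mat_kernel (struct_rows K R)"
    and "(\<And>j. j < struct_dim K R \<Longrightarrow> (\<Sum>s=1..R. w s * a s $ j) = 0) \<Longrightarrow> s \<in> {1..R} \<Longrightarrow> w s = 0"
proof -
  interpret kernel "struct_dim K R - R" "struct_dim K R" "struct_rows K R"
    by unfold_locales (simp add: struct_rows_def)
  have inj: "inj_on a {1..R}" and basis: "Ker.basis (a ` {1..R})"
    using assms by (auto simp: kernel_basis_def)
  have sub: "a ` {1..R} \<subseteq> mat_kernel (struct_rows K R)" and indpt: "Ker.lin_indpt (a ` {1..R})"
    using basis by (auto simp: Ker.basis_def)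
  show "a s \<in> mat_kernel (struct_rows K R)" if "s \<in> {1..R}"
    using sub that by blast
  show "w s = 0" if zero: "\<And>j. j < struct_dim K R \<Longrightarrow> (\<Sum>s=1..R. w s * a s $ j) = 0"
    and s: "s \<in> {1..R}"
  proof (rule ccontr)
    assume "w s \<noteq> 0"
    \<comment> \<open>Coefficients are moved from the indices to the set of vectors, which is
      possible because the family is injective.\<close>
    define c where "c = w \<circ> the_inv_into {1..R} a"
    have c: "c (a t) = w t" if "t \<in> {1..R}" for t
      using that inj by (simp add: c_def the_inv_into_f_f)
    have lin: "lincomb c (a ` {1..R}) \<in> mat_kernel (struct_rows K R)"
      using sub by (intro Ker.lincomb_closed) auto
    have "lincomb c (a ` {1..R}) = 0\<^sub>v (struct_dim K R)"
    proof (rule eq_vecI)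
      fix j assume "j < dim_vec (0\<^sub>v (struct_dim K R))"
      then have j: "j < struct_dim K R"
        by simp
      have "lincomb c (a ` {1..R}) $ j = (\<Sum>t=1..R. c (a t) * a t $ j)"
        by (simp only: lincomb_index[OF j sub] sum.reindex[OF inj] o_def)
      also have "\<dots> = (\<Sum>t=1..R. w t * a t $ j)"
        by (intro sum.cong) (simp_all add: c)
      finally show "lincomb c (a ` {1..R}) $ j = 0\<^sub>v (struct_dim K R) $ j"
        using zero[OF j] j by simp
    qed (use mat_kernelD(1)[OF A lin] in simp)
    then have "Ker.lin_dep (a ` {1..R})"
      unfolding Ker.lin_dep_def using s \<open>w s \<noteq> 0\<close> c
      by (intro exI[of _ "a ` {1..R}"] exI[of _ c] exI[of _ "a s"]) auto
    then show False
      using indpt by simp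
  qed
qed

lemma hermite_form_combination:
  "hermite_form K R (\<lambda>k r. \<Sum>s\<in>S. w s * \<alpha> s k r) p = (\<Sum>s\<in>S. w s * hermite_form K R (\<alpha> s) p)"
  by (induction S rule: infinite_finite_induct)
     (simp_all add: hermite_form_def distrib_right sum.distrib sum_distrib_left mult.assoc)

section \<open>Solvability of the scheme and its amplification function\<close>

context
  fixes K R :: nat and a :: "nat \<Rightarrow> real vec" and z :: complex
  assumes basis: "kernel_basis K R a" and nz: "stage_value K R 0 z \<noteq> 0" and R: "0 < R"
begin

lemma hermite_form_scheme_row:
  assumes "s \<in> {1..R}" "degree p \<le> K * (R + 1)"
  shows "hermite_form K R (\<lambda>k r. of_real (scheme_coeff R a s k r)) p = 0"
  using hermite_form_kernel_vector[OF kernel_basisD(1)[OF basis assms(1)] assms(2)]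
  by (simp add: scheme_coeff_def)

text \<open>Real vectors independent over the reals stay independent over the complex numbers: real
  and imaginary parts of the weights are treated separately.\<close>

lemma scheme_coeff_independent:
  assumes "\<And>k r. k \<le> K \<Longrightarrow> r \<le> R \<Longrightarrow> (\<Sum>s=1..R. w s * complex_of_real (scheme_coeff R a s k r)) = 0"
    and s: "s \<in> {1..R}"
  shows "w s = 0"
proof -
  have zero: "(\<Sum>s=1..R. w s * complex_of_real (a s $ j)) = 0" if j: "j < struct_dim K R" for j
  proof -
    have "j div (R + 1) < K + 1"
      using j unfolding struct_dim_def by (rule less_mult_imp_div_less)
    then have k: "j div (R + 1) \<le> K"
      by linarith
    have "j mod (R + 1) < R + 1"
      by (rule mod_less_divisor) simp
    then have r: "j mod (R + 1) \<le> R"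
      by linarith
    have ell: "ell R (j div (R + 1)) (j mod (R + 1)) - 1 = j"
      by (simp only: ell_def add.assoc diff_add_inverse div_mult_mod_eq)
    show ?thesis
      using assms(1)[OF k r] unfolding scheme_coeff_def ell .
  qed
  have "(\<Sum>s=1..R. Re (w s) * a s $ j) = 0" "(\<Sum>s=1..R. Im (w s) * a s $ j) = 0"
    if "j < struct_dim K R" for j
    using arg_cong[OF zero[OF that], of Re] arg_cong[OF zero[OF that], of Im] by simp_all
  then have "Re (w s) = 0" "Im (w s) = 0"
    using kernel_basisD(2)[OF basis _ s, where w = "\<lambda>s. Re (w s)"]
      kernel_basisD(2)[OF basis _ s, where w = "\<lambda>s. Im (w s)"] by simp_all
  then show ?thesis
    by (simp add: complex_eq_iff)
qed

text \<open>A null vector of the transpose combines the scheme rows into an exact functional whose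
  symbols at z vanish for the nodes 1, ..., R. The stage value relation with \<open>nz\<close>
  forces the symbol at node 0 to vanish too, so the functional is zero, against independence of the
  rows.\<close>

lemma det_G_mat_nonzero: "det (G_mat K R a z) \<noteq> 0"
proof
  assume "det (G_mat K R a z) = 0"
  moreover have G: "G_mat K R a z \<in> carrier_mat R R"
    by (simp add: G_mat_def)
  ultimately have "det (transpose_mat (G_mat K R a z)) = 0"
    by (simp add: det_transpose)
  then obtain v where v: "v \<in> carrier_vec R" "v \<noteq> 0\<^sub>v R"
    "transpose_mat (G_mat K R a z) *\<^sub>v v = 0\<^sub>v R"
    using det_0_iff_vec_prod_zero_field[of "transpose_mat (G_mat K R a z)" R] G by auto
  define \<alpha> where "\<alpha> k r = (\<Sum>s=1..R. v $ (s - 1) * complex_of_real (scheme_coeff R a s k r))" for k r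
  have exact: "hermite_form K R \<alpha> p = 0" if "degree p \<le> K * (R + 1)" for p
    unfolding \<alpha>_def hermite_form_combination using that by (simp add: hermite_form_scheme_row)
  have column: "(\<Sum>k\<le>K. \<alpha> k r * z ^ k) = (\<Sum>s=1..R. v $ (s - 1) * g_poly K R a s r z)" for r
  proof -
    have "(\<Sum>k\<le>K. \<alpha> k r * z ^ k)
        = (\<Sum>k\<le>K. \<Sum>s=1..R. v $ (s - 1) * (complex_of_real (scheme_coeff R a s k r) * z ^ k))"
      by (simp add: \<alpha>_def sum_distrib_right mult.assoc)
    also have "\<dots> = (\<Sum>s=1..R. \<Sum>k\<le>K. v $ (s - 1) * (complex_of_real (scheme_coeff R a s k r) * z ^ k))"
      by (rule sum.swap)
    finally show ?thesis
      by (simp add: g_poly_def sum_distrib_left atMost_atLeast0)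
  qed
  have inner: "(\<Sum>k\<le>K. \<alpha> k r * z ^ k) = 0" if r: "r \<in> {1..R}" for r
  proof -
    have "0 = (transpose_mat (G_mat K R a z) *\<^sub>v v) $ (r - 1)"
      using v r by auto
    also have "\<dots> = (\<Sum>i<R. v $ i * g_poly K R a (Suc i) r z)"
      using v(1) r by (auto simp: scalar_prod_def G_mat_def atLeast0LessThan intro!: sum.cong)
    also have "\<dots> = (\<Sum>k\<le>K. \<alpha> k r * z ^ k)"
      unfolding column by (simp add: sum.atLeast1_atMost_eq)
    finally show ?thesis ..
  qed
  have "0 = (\<Sum>r\<le>R. stage_value K R r z * (\<Sum>k\<le>K. \<alpha> k r * z ^ k))"
    using stage_value_relation[OF exact] by simp
  also have "\<dots> = stage_value K R 0 z * (\<Sum>k\<le>K. \<alpha> k 0 * z ^ k)"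
    using inner by (subst sum.atMost_shift) (simp add: sum.neutral)
  finally have "(\<Sum>k\<le>K. \<alpha> k 0 * z ^ k) = 0"
    using nz by simp
  then have "(\<Sum>k\<le>K. \<alpha> k r * z ^ k) = 0" if "r \<le> R" for r
    using inner[of r] that by (cases "r = 0") auto
  then have "\<alpha> k r = 0" if "k \<le> K" "r \<le> R" for k r
    using hermite_form_eq_0_imp[OF exact] that by blast
  then have "v $ (s - 1) = 0" if "s \<in> {1..R}" for s
    using scheme_coeff_independent[of "\<lambda>s. v $ (s - 1)"] that unfolding \<alpha>_def by blast
  then have "v $ i = 0" if "i < R" for i
    using that by (metis Suc_leI atLeastAtMost_iff diff_Suc_1 le_add1 plus_1_eq_Suc)
  then show False
    using v by auto
qed

lemma scheme_solution:
  assumes "s \<in> {1..R}"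
  shows "(\<Sum>r=1..R. g_poly K R a s r z * stage_value K R r z) = - g_poly K R a s 0 z * stage_value K R 0 z"
proof -
  have "0 = (\<Sum>r\<le>R. stage_value K R r z * g_poly K R a s r z)"
    using stage_value_relation[OF hermite_form_scheme_row[OF assms]]
    by (simp add: g_poly_def atMost_atLeast0)
  also have "\<dots> = stage_value K R 0 z * g_poly K R a s 0 z
      + (\<Sum>r=1..R. stage_value K R r z * g_poly K R a s r z)"
    by (subst sum.atMost_shift) (simp add: sum.atLeast1_atMost_eq)
  finally show ?thesis
    by (simp add: eq_neg_iff_add_eq_0 mult.commute add.commute)
qed

lemma G_mat_invertible: "invertible_mat (G_mat K R a z)"
  and amplification_eq: "amplification K R a z = stage_value K R R z / stage_value K R 0 z"
proof -
  let ?G = "G_mat K R a z"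
  have G: "?G \<in> carrier_mat R R"
    by (simp add: G_mat_def)
  obtain B where B: "mat_inverse ?G = Some B"
    using mat_inverse(1)[OF G] det_non_zero_imp_unit[OF G det_G_mat_nonzero] by fastforce
  then have inv: "?G * B = 1\<^sub>m R" "B * ?G = 1\<^sub>m R" "B \<in> carrier_mat R R"
    using mat_inverse(2)[OF G] by auto
  then show "invertible_mat ?G"
    using G by (auto simp: invertible_mat_def inverts_mat_def)
  let ?b = "b_vec K R a z"
  have b: "?b \<in> carrier_vec R"
    by (simp add: b_vec_def)
  \<comment> \<open>Stage values left undivided: \<open>u\<close> solves the system with right side
    multiplied by \<open>stage_value K R 0 z\<close>.\<close>
  define u where "u = vec R (\<lambda>i. stage_value K R (Suc i) z)"
  have u: "u \<in> carrier_vec R"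
    by (simp add: u_def)
  have "?G *\<^sub>v u = - stage_value K R 0 z \<cdot>\<^sub>v ?b"
  proof (rule eq_vecI)
    fix i assume "i < dim_vec (- stage_value K R 0 z \<cdot>\<^sub>v ?b)"
    then have i: "i < R"
      by (simp add: b_vec_def)
    have "(?G *\<^sub>v u) $ i = (\<Sum>j<R. g_poly K R a (Suc i) (Suc j) z * stage_value K R (Suc j) z)"
      using i by (simp add: scalar_prod_def G_mat_def u_def atLeast0LessThan)
    also have "\<dots> = (- stage_value K R 0 z \<cdot>\<^sub>v ?b) $ i"
      using scheme_solution[of "Suc i"] i by (simp add: b_vec_def sum.atLeast1_atMost_eq)
    finally show "(?G *\<^sub>v u) $ i = (- stage_value K R 0 z \<cdot>\<^sub>v ?b) $ i" .
  qed (simp add: G_mat_def b_vec_def)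
  then have "B *\<^sub>v (?G *\<^sub>v u) = - stage_value K R 0 z \<cdot>\<^sub>v (B *\<^sub>v ?b)"
    using inv(3) b by (simp add: mult_mat_vec)
  moreover have "B *\<^sub>v (?G *\<^sub>v u) = u"
    using assoc_mult_mat_vec[OF inv(3) G u] inv(2) u by simp
  ultimately have "u $ (R - 1) = - stage_value K R 0 z * (B *\<^sub>v ?b) $ (R - 1)"
    using inv(3) R by simp
  then have "stage_value K R R z = stage_value K R 0 z * amplification K R a z"
    using inv(3) R by (simp add: u_def amplification_def amplification_vec_def B)
  then show "amplification K R a z = stage_value K R R z / stage_value K R 0 z"
    using nz by simp
qed

end

section \<open>Continued fractions and the half plane\<close>

fun routh_pair :: "real list \<Rightarrow> real \<Rightarrow> complex poly \<times> complex poly" where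
  "routh_pair [] c = ([:of_real c:], 0)"
| "routh_pair (a # as) c =
    (let (u, v) = routh_pair as c in (pCons 0 (Polynomial.smult (of_real a) u) + v, u))"

text \<open>Where defined, u / v is a w + 1 / (u' / v') for the pair u', v' of the tail, and both
  summands preserve nonnegative real part. The form Re (u cnj v) avoids division and so includes
  zeros of v.\<close>

lemma routh_pair_half_plane:
  assumes "\<forall>a\<in>set as. 0 \<le> a" "c \<noteq> 0" "0 \<le> Re w" "routh_pair as c = (u, v)"
  shows "0 \<le> Re (poly u w * cnj (poly v w)) \<and> (poly u w \<noteq> 0 \<or> poly v w \<noteq> 0)"
  using assms
proof (induction as arbitrary: u v)
  case (Cons a as)
  obtain u' v' where uv: "routh_pair as c = (u', v')"
    by fastforce
  let ?x = "poly u' w" and ?y = "poly v' w"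
  have u: "poly u w = of_real a * w * ?x + ?y" and v: "poly v w = ?x"
    using Cons.prems uv by auto
  have IH: "0 \<le> Re (?x * cnj ?y)" "?x \<noteq> 0 \<or> ?y \<noteq> 0"
    using Cons.IH[OF _ _ _ uv] Cons.prems by auto
  have "poly u w * cnj (poly v w) = of_real a * w * (?x * cnj ?x) + cnj (?x * cnj ?y)"
    by (simp add: u v algebra_simps)
  then have "Re (poly u w * cnj (poly v w)) = a * Re w * (cmod ?x)\<^sup>2 + Re (?x * cnj ?y)"
    by (simp only: complex_norm_square[symmetric] plus_complex.sel cnj.sel) simp
  moreover have "0 \<le> a * Re w * (cmod ?x)\<^sup>2"
    using Cons.prems by simp
  moreover have "poly u w \<noteq> 0 \<or> poly v w \<noteq> 0"
    using IH(2) by (auto simp: u v)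
  ultimately show ?case
    using IH(1) by simp
qed auto

lemma routh_pair_parity:
  assumes "routh_pair as c = (u, v)"
  shows "poly u (- w) = (- 1) ^ length as * poly u w" "poly v (- w) = - ((- 1) ^ length as * poly v w)"
  using assms
proof (induction as arbitrary: u v)
  case (Cons a as)
  obtain u' v' where uv: "routh_pair as c = (u', v')"
    by fastforce
  {
    case 1
    then show ?case
      using Cons.IH[OF uv] uv by (auto simp: algebra_simps)
  next
    case 2
    then show ?case
      using Cons.IH[OF uv] uv by auto
  }
qed auto

text \<open>The squares differ by 4 Re (x cnj y).\<close>

lemma norm_diff_le_norm_add:
  assumes "0 \<le> Re (x * cnj y)"
  shows "cmod (x - y) \<le> cmod (x + y)"
proof (rule power2_le_imp_le)
  show "(cmod (x - y))\<^sup>2 \<le> (cmod (x + y))\<^sup>2"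
    unfolding cmod_power2 using assms by (simp add: power2_eq_square algebra_simps)
qed simp

text \<open>The point -z lies in the right half plane. As u and v have opposite parities, u - v at z
  is, up to sign, u + v at -z, so the bound compares x - y with x + y there.\<close>

lemma routh_pair_bound:
  assumes "routh_pair as c = (u, v)" "\<forall>a\<in>set as. 0 \<le> a" "c \<noteq> 0" "Re z \<le> 0"
  shows "poly (u - v) z \<noteq> 0" "cmod (poly (u - v) (- z)) \<le> cmod (poly (u - v) z)"
proof -
  let ?x = "poly u (- z)" and ?y = "poly v (- z)"
  have pos: "0 \<le> Re (?x * cnj ?y)" "?x \<noteq> 0 \<or> ?y \<noteq> 0"
    using routh_pair_half_plane[OF assms(2,3) _ assms(1), of "- z"] assms(4) by auto
  have z: "poly (u - v) z = (- 1) ^ length as * (?x + ?y)"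
    using routh_pair_parity[OF assms(1), of "- z"] by (simp add: algebra_simps)
  show "poly (u - v) z \<noteq> 0"
  proof
    assume "poly (u - v) z = 0"
    then have "(- 1) ^ length as * (?x + ?y) = 0"
      by (simp only: z)
    then have y: "?y = - ?x"
      by (simp add: eq_neg_iff_add_eq_0 add.commute)
    \<comment> \<open>A negative real part unless x, and with it y, is zero; both cases contradict
      \<open>pos\<close>.\<close>
    then have "?x * cnj ?y = - of_real ((cmod ?x)\<^sup>2)"
      by (simp flip: complex_norm_square)
    then show False
      using pos y by simp
  qed
  show "cmod (poly (u - v) (- z)) \<le> cmod (poly (u - v) z)"
    using norm_diff_le_norm_add[OF pos(1)] unfolding z by (simp add: norm_mult norm_power)
qed

section \<open>Certificates for the nine pairs of parameters\<close>

lemma stage_value_0: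
  "stage_value K R 0 z = (\<Sum>j\<le>K * (R + 1). fact j * coeff (nodal R ^ K) j * z ^ (K * (R + 1) - j))"
  by (simp add: stage_value_def resolvent_sum_def poly_sum poly_higher_pderiv mult.commute)

text \<open>The last clause is an identity between explicit polynomials, so each certificate is
  checked by computation; it says that u - v represents z ->
  \<open>stage_value K R 0 z\<close>.\<close>

definition routh_certificate :: "nat \<Rightarrow> nat \<Rightarrow> real list \<Rightarrow> real \<Rightarrow> bool" where
  "routh_certificate K R as c \<longleftrightarrow> c \<noteq> 0 \<and> (\<forall>a\<in>set as. 0 \<le> a) \<and>
     fst (routh_pair as c) - snd (routh_pair as c)
       = (\<Sum>j\<le>K * (R + 1). monom (fact j * coeff (nodal R ^ K) j) (K * (R + 1) - j))"

lemma routh_certificate_imp: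
  assumes "routh_certificate K R as c" "Re z \<le> 0"
  shows "stage_value K R 0 z \<noteq> 0" "cmod (stage_value K R 0 (- z)) \<le> cmod (stage_value K R 0 z)"
proof -
  obtain u v where uv: "routh_pair as c = (u, v)"
    by fastforce
  have "stage_value K R 0 x = poly (u - v) x" for x
    using assms(1) by (simp add: stage_value_0 routh_certificate_def uv poly_sum poly_monom)
  then show "stage_value K R 0 z \<noteq> 0" "cmod (stage_value K R 0 (- z)) \<le> cmod (stage_value K R 0 z)"
    using routh_pair_bound[OF uv _ _ assms(2)] assms(1) by (simp_all add: routh_certificate_def)
qed

lemma nodal_1: "nodal 1 = [:0, -1, 1 :: complex:]"
  by (simp add: nodal_def)

lemma nodal_2: "nodal 2 = [:0, 2, -3, 1 :: complex:]"
  by (simp add: nodal_def numeral_2_eq_2)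

lemma nodal_3: "nodal 3 = [:0, -6, 11, -6, 1 :: complex:]"
  by (simp add: nodal_def numeral_3_eq_3)

text \<open>Routh's algorithm for \<open>stage_value K R 0 (- w)\<close> yields the lists; the last constant is
  \<open>(- 1) ^ (K * R) * fact (K * (R + 1))\<close>.\<close>

lemma routh_certificate_table:
  shows "routh_certificate 1 1 [1 / 2] (- 2)"
  and "routh_certificate 1 2 [1 / 3, 1] 6"
  and "routh_certificate 1 3 [3 / 11, 121 / 162, 27 / 22] (- 24)"
  and "routh_certificate 2 1 [1 / 6, 1 / 2] 24"
  and "routh_certificate 2 2 [1 / 9, 9 / 29, 841 / 1800, 20 / 29] 720"
  and "routh_certificate 2 3 [1 / 11, 363 / 1403, 1968409 / 5078700, 21930750 / 46827931,
      1114024129 / 2058720300, 51597 / 66754] 40320"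
  and "routh_certificate 3 1 [1 / 12, 6 / 25, 5 / 12] (- 720)"
  and "routh_certificate 3 2 [1 / 18, 4 / 25, 375 / 1526, 11881 / 38525, 11873405 / 32145408,
      4096 / 7705] 362880"
  and "routh_certificate 3 3 [1 / 22, 4356 / 32735, 214316045 / 1017088534,
      43619037189841 / 160692868800990, 714157529282127 / 2314138770856004,
      7673309917799761 / 23830148648384235, 123692967797375205 / 370691053904712478,
      639563159821926823 / 1631184462653744295, 5091158853 / 8463514276] (- 479001600)"
  unfolding routh_certificate_def nodal_1 nodal_2 nodal_3
  by (simp_all add: numeral_eq_Suc monom_Suc monom_0)

theorem corollary9p6:
  fixes K R :: nat and a :: "nat \<Rightarrow> real vec"
  assumes "K \<in> {1, 2, 3}" and "R \<in> {1, 2, 3}"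
    and "kernel_basis K R a"
  shows "A_stable K R a"
proof -
  obtain as c where cert: "routh_certificate K R as c"
    using assms(1,2) routh_certificate_table by blast
  have "invertible_mat (G_mat K R a z) \<and> cmod (amplification K R a z) \<le> 1" if "Re z \<le> 0" for z
  proof -
    note bound = routh_certificate_imp[OF cert that]
    have R: "0 < R"
      using assms(2) by auto
    have "cmod (amplification K R a z) \<le> 1"
      unfolding amplification_eq[OF assms(3) bound(1) R] stage_value_reflect norm_divide
      using bound by simp
    then show ?thesis
      using G_mat_invertible[OF assms(3) bound(1) R] by simp
  qed
  then show ?thesis
    by (simp add: A_stable_def)
qed

end
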